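(* If $X$ and $Y$ are homotopy equivalent completely $\pi_n$-rigid spaces, then $\mathbf{w}_n(X)$ and $\mathbf{w}_n(Y)$ are homeomorphic.
   Context: Here $n\ge 0$ is an integer. All spaces are Hausdorff and maps are continuous. A map $S^n\to X$ is essential if it is not null-homotopic. The $n$-dimensional infinite earring $\mathbb{E}_n$ is the shrinking wedge of copies $S^n_j$ ($j\in\mathbb{N}$) of $S^n$: as a set it is the one-point union $\bigvee_{j}S^n_j$ with wedge point $b_0$; a set $U$ is open iff $U\cap S^n_j$ is open in $S^n_j$ for all $j$ and, whenever $b_0\in U$, $S^n_j\subseteq U$ for all but finitely many $j$. A map $f:\mathbb{E}_n\to X$ is fully essential if its restriction to $S^n_j$ is essential in $X$ for every $j$. The $\pi_n$-wild set $\mathbf{w}_n(X)$ is the subspace of all $x\in X$ for which there is a fully essential map $(\mathbb{E}_n,b_0)\to(X,x)$. $X$ is $\pi_n$-rigid at $x\in X$ if there exists a fully essential map $f:(\mathbb{E}_n,b_0)\to(X,x)$ such that every map $F:\mathbb{E}_n\times[0,1]\to X$ with $F(a,0)=f(a)$ for all $a\in\mathbb{E}_n$ satisfies $F(b_0,1)=x$. $\mathbf{rg}_n(X)$ is the set of $x$ at which $X$ is $\pi_n$-rigid, and $X$ is completely $\pi_n$-rigid if $\mathbf{rg}_n(X)=\mathbf{w}_n(X)$. *)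

theory Defs
  imports "HOL-Analysis.Analysis"
begin

definition sphere_base :: "nat \<Rightarrow> real"
  where "sphere_base = (\<lambda>i. if i = 0 then 1 else 0)"

text \<open>Points of the one-point union of the spheres \<open>S\<^sup>n\<^sub>j\<close> (\<open>j \<in> \<nat>\<close>): \<^term>\<open>None\<close> is the wedge
  point \<open>b\<^sub>0\<close>, and \<open>Some (j, x)\<close> is the point \<open>x\<close> of \<open>S\<^sup>n\<^sub>j\<close> for \<open>x\<close> different from
  the base point of the sphere. The map \<open>earring_incl j\<close> is the inclusion of \<open>S\<^sup>n\<^sub>j\<close>.\<close>

type_synonym earring_point = "(nat \<times> (nat \<Rightarrow> real)) option"

definition earring_incl :: "nat \<Rightarrow> (nat \<Rightarrow> real) \<Rightarrow> earring_point"
  where "earring_incl j x = (if x = sphere_base then None else Some (j, x))"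

definition earring_carrier :: "nat \<Rightarrow> earring_point set"
  where "earring_carrier n = (\<Union>j. earring_incl j ` topspace (nsphere n))"

definition earring_open :: "nat \<Rightarrow> earring_point set \<Rightarrow> bool"
  where "earring_open n U \<longleftrightarrow>
    U \<subseteq> earring_carrier n \<and>
    (\<forall>j. openin (nsphere n) {x \<in> topspace (nsphere n). earring_incl j x \<in> U}) \<and>
    (None \<in> U \<longrightarrow> finite {j. \<not> earring_incl j ` topspace (nsphere n) \<subseteq> U})"

definition earring :: "nat \<Rightarrow> earring_point topology"
  where "earring n = topology (earring_open n)"

lemma istopology_earring_open: "istopology (earring_open n)"
  unfolding istopology_def
proof (intro conjI allI impI)
  fix S T assume S: "earring_open n S" and T: "earring_open n T"
  have eq: "{x \<in> topspace (nsphere n). earring_incl j x \<in> S \<inter> T} =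
      {x \<in> topspace (nsphere n). earring_incl j x \<in> S} \<inter>
      {x \<in> topspace (nsphere n). earring_incl j x \<in> T}" for j
    by auto
  have "finite {j. \<not> earring_incl j ` topspace (nsphere n) \<subseteq> S \<inter> T}" if "None \<in> S \<inter> T"
  proof (rule finite_subset)
    show "{j. \<not> earring_incl j ` topspace (nsphere n) \<subseteq> S \<inter> T} \<subseteq>
        {j. \<not> earring_incl j ` topspace (nsphere n) \<subseteq> S} \<union>
        {j. \<not> earring_incl j ` topspace (nsphere n) \<subseteq> T}"
      by blast
    show "finite ({j. \<not> earring_incl j ` topspace (nsphere n) \<subseteq> S} \<union>
        {j. \<not> earring_incl j ` topspace (nsphere n) \<subseteq> T})"
      using that S T unfolding earring_open_def by blast
  qed
  then show "earring_open n (S \<inter> T)"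
    using S T unfolding earring_open_def eq by blast
next
  fix \<K> assume K: "\<forall>K\<in>\<K>. earring_open n K"
  have eq: "{x \<in> topspace (nsphere n). earring_incl j x \<in> \<Union>\<K>} =
      (\<Union>K\<in>\<K>. {x \<in> topspace (nsphere n). earring_incl j x \<in> K})" for j
    by auto
  have op: "openin (nsphere n) {x \<in> topspace (nsphere n). earring_incl j x \<in> \<Union>\<K>}" for j
    unfolding eq using K unfolding earring_open_def by blast
  have fin: "finite {j. \<not> earring_incl j ` topspace (nsphere n) \<subseteq> \<Union>\<K>}" if b: "None \<in> \<Union>\<K>"
  proof -
    obtain K where K': "K \<in> \<K>" "None \<in> K"
      using b by blast
    show ?thesis
    proof (rule finite_subset)
      show "{j. \<not> earring_incl j ` topspace (nsphere n) \<subseteq> \<Union>\<K>} \<subseteq>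
          {j. \<not> earring_incl j ` topspace (nsphere n) \<subseteq> K}"
        using K' by blast
      show "finite {j. \<not> earring_incl j ` topspace (nsphere n) \<subseteq> K}"
        using K K' unfolding earring_open_def by blast
    qed
  qed
  have sub: "\<Union>\<K> \<subseteq> earring_carrier n"
    using K unfolding earring_open_def by blast
  show "earring_open n (\<Union>\<K>)"
    unfolding earring_open_def using sub op fin by blast
qed

lemma openin_earring: "openin (earring n) = earring_open n"
  unfolding earring_def using istopology_earring_open by (rule topology_inverse')

lemma topspace_earring: "topspace (earring n) = earring_carrier n"
proof (rule topspace_def [THEN trans], rule antisym)
  show "\<Union>{T. openin (earring n) T} \<subseteq> earring_carrier n"
    by (auto simp: openin_earring earring_open_def)
  have "earring_incl j x \<in> earring_carrier n" if "x \<in> topspace (nsphere n)" for j x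
    using that by (auto simp: earring_carrier_def)
  then have "{x \<in> topspace (nsphere n). earring_incl j x \<in> earring_carrier n}
      = topspace (nsphere n)" for j
    by auto
  moreover have "{j. \<not> earring_incl j ` topspace (nsphere n) \<subseteq> earring_carrier n} = {}"
    by (auto simp: earring_carrier_def)
  ultimately have "earring_open n (earring_carrier n)"
    unfolding earring_open_def by simp
  then show "earring_carrier n \<subseteq> \<Union>{T. openin (earring n) T}"
    by (auto simp: openin_earring)
qed

definition essential_map :: "nat \<Rightarrow> 'a topology \<Rightarrow> ((nat \<Rightarrow> real) \<Rightarrow> 'a) \<Rightarrow> bool"
  where "essential_map n X g \<longleftrightarrow>
    continuous_map (nsphere n) X g \<and>
    \<not> (\<exists>c. homotopic_with (\<lambda>_. True) (nsphere n) X g (\<lambda>_. c))"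

definition fully_essential :: "nat \<Rightarrow> 'a topology \<Rightarrow> (earring_point \<Rightarrow> 'a) \<Rightarrow> bool"
  where "fully_essential n X f \<longleftrightarrow>
    continuous_map (earring n) X f \<and> (\<forall>j. essential_map n X (f \<circ> earring_incl j))"

definition wild_set :: "nat \<Rightarrow> 'a topology \<Rightarrow> 'a set"
  where "wild_set n X = {x \<in> topspace X. \<exists>f. fully_essential n X f \<and> f None = x}"

definition rigid_at :: "nat \<Rightarrow> 'a topology \<Rightarrow> 'a \<Rightarrow> bool"
  where "rigid_at n X x \<longleftrightarrow>
    (\<exists>f. fully_essential n X f \<and> f None = x \<and>
      (\<forall>F. continuous_map (prod_topology (earring n) (top_of_set {0..1::real})) X F \<and>
           (\<forall>a \<in> topspace (earring n). F (a, 0) = f a)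
           \<longrightarrow> F (None, 1) = x))"

definition rigid_set :: "nat \<Rightarrow> 'a topology \<Rightarrow> 'a set"
  where "rigid_set n X = {x \<in> topspace X. rigid_at n X x}"

definition completely_rigid :: "nat \<Rightarrow> 'a topology \<Rightarrow> bool"
  where "completely_rigid n X \<longleftrightarrow> rigid_set n X = wild_set n X"

end

theory Submission
  imports Defs
begin

text \<open>A homotopy equivalence carries fully essential maps to fully essential maps, hence wild points
  to wild points. A homotopy from the identity to \<open>g \<circ> f\<close>, restricted along a fully essential map
  witnessing rigidity at \<open>x\<close>, shows \<open>g (f x) = x\<close>. So mutually inverse homotopy equivalences restrict
  to mutually inverse homeomorphisms of the wild sets.\<close>

text \<open>A null-homotopy of \<open>f \<circ> a\<close>, pushed forward by \<open>g\<close>,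
  contracts \<open>g \<circ> f \<circ> a\<close>, which is homotopic to \<open>a\<close>. All
  homotopies are free, so no base point has to be tracked.\<close>

lemma essential_map_compose:
  assumes a: "essential_map n X a"
    and f: "continuous_map X Y f" and g: "continuous_map Y X g"
    and gf: "homotopic_with (\<lambda>_. True) X X (g \<circ> f) id"
  shows "essential_map n Y (f \<circ> a)"
  unfolding essential_map_def
proof (intro conjI notI)
  have ca: "continuous_map (nsphere n) X a"
    using a by (simp add: essential_map_def)
  show "continuous_map (nsphere n) Y (f \<circ> a)"
    using ca f by (rule continuous_map_compose)
  assume "\<exists>c. homotopic_with (\<lambda>_. True) (nsphere n) Y (f \<circ> a) (\<lambda>_. c)"
  then obtain c where "homotopic_with (\<lambda>_. True) (nsphere n) Y (f \<circ> a) (\<lambda>_. c)"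
    by blast
  then have "homotopic_with (\<lambda>_. True) (nsphere n) X (g \<circ> (f \<circ> a)) (g \<circ> (\<lambda>_. c))"
    using g by (rule homotopic_with_compose_continuous_map_left) auto
  moreover have "homotopic_with (\<lambda>_. True) (nsphere n) X ((g \<circ> f) \<circ> a) (id \<circ> a)"
    using gf ca by (rule homotopic_with_compose_continuous_map_right) auto
  \<comment> \<open>\<open>g \<circ> (\<lambda>_. c)\<close> is the constant map at
    \<open>g c\<close>; the second homotopy is reversed so that the chain starts at
    \<open>a\<close>.\<close>
  ultimately have "homotopic_with (\<lambda>_. True) (nsphere n) X a (\<lambda>_. g c)"
    using homotopic_with_trans[OF homotopic_with_symD] by (fastforce simp: comp_def)
  then show False
    using a by (auto simp: essential_map_def)
qed

lemma fully_essential_compose: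
  assumes "fully_essential n X a"
    and "continuous_map X Y f" and "continuous_map Y X g"
    and "homotopic_with (\<lambda>_. True) X X (g \<circ> f) id"
  shows "fully_essential n Y (f \<circ> a)"
  using assms unfolding fully_essential_def
  by (metis comp_assoc continuous_map_compose essential_map_compose)

text \<open>If \<open>a\<close> witnesses wildness at \<open>x\<close>, then
  \<open>f \<circ> a\<close> does so at \<open>f x\<close>. Exchanging the roles of the two spaces
  gives the inclusion for \<open>g\<close>.\<close>

lemma wild_set_image_subset:
  assumes "continuous_map X Y f" and "continuous_map Y X g"
    and "homotopic_with (\<lambda>_. True) X X (g \<circ> f) id"
  shows "f ` wild_set n X \<subseteq> wild_set n Y"
proof clarify
  fix x assume "x \<in> wild_set n X"
  then obtain a where x: "x \<in> topspace X" and a: "fully_essential n X a" "a None = x"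
    unfolding wild_set_def by blast
  have "fully_essential n Y (f \<circ> a)" "(f \<circ> a) None = f x"
    using fully_essential_compose[OF a(1) assms] a(2) by auto
  moreover have "f x \<in> topspace Y"
    using x assms(1) by (auto simp: continuous_map_def)
  ultimately show "f x \<in> wild_set n Y"
    unfolding wild_set_def by blast
qed

lemma rigid_set_fixed:
  assumes "homotopic_with (\<lambda>_. True) X X id h" and "x \<in> rigid_set n X"
  shows "h x = x"
proof -
  obtain H where H: "continuous_map (prod_topology (top_of_set {0..1::real}) X) X H"
      "\<And>y. H (0, y) = y" "\<And>y. H (1, y) = h y"
    using assms(1) unfolding homotopic_with_def by auto
  obtain a where a: "fully_essential n X a" "a None = x"
    and rigid: "\<And>F. continuous_map (prod_topology (earring n) (top_of_set {0..1::real})) X F \<Longrightarrow>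
      (\<forall>z \<in> topspace (earring n). F (z, 0) = a z) \<Longrightarrow> F (None, 1) = x"
    using assms(2) unfolding rigid_set_def rigid_at_def by blast
  let ?E = "prod_topology (earring n) (top_of_set {0..1::real})"
  have ca: "continuous_map (earring n) X a"
    using a(1) by (simp add: fully_essential_def)
  \<comment> \<open>The pairing swaps the factors: \<open>H\<close> takes time first, whereas
    \<open>rigid_at\<close> takes it second.\<close>
  have "continuous_map ?E (prod_topology (top_of_set {0..1::real}) X) (\<lambda>p. (snd p, (a \<circ> fst) p))"
    using continuous_map_snd continuous_map_compose[OF continuous_map_fst ca]
    by (rule continuous_map_pairedI)
  then have "continuous_map ?E X (H \<circ> (\<lambda>p. (snd p, (a \<circ> fst) p)))"
    using H(1) by (rule continuous_map_compose)
  \<comment> \<open>The deformation \<open>F (z, t) = H (t, a z)\<close> starts at \<open>a\<close>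
    and moves the wedge point to \<open>H (1, x) = h x\<close>.\<close>
  from rigid[OF this] show ?thesis
    by (simp add: H a(2))
qed

theorem theorem6p7:
  fixes n :: nat and X :: "'a topology" and Y :: "'b topology"
  assumes "Hausdorff_space X" and "Hausdorff_space Y"
    and "completely_rigid n X" and "completely_rigid n Y"
    and "X homotopy_equivalent_space Y"
  shows "subtopology X (wild_set n X) homeomorphic_space subtopology Y (wild_set n Y)"
proof -
  obtain f g where f: "continuous_map X Y f" and g: "continuous_map Y X g"
    and gf: "homotopic_with (\<lambda>_. True) X X (g \<circ> f) id"
    and fg: "homotopic_with (\<lambda>_. True) Y Y (f \<circ> g) id"
    using assms(5) unfolding homotopy_equivalent_space_def by blast
  \<comment> \<open>Complete rigidity makes the wild point \<open>x\<close> rigid; the homotopy is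
    reversed to start at \<open>id\<close>.\<close>
  have "g (f x) = x" if "x \<in> wild_set n X" for x
    using rigid_set_fixed[OF homotopic_with_symD[OF gf], of x n] that assms(3)
    by (simp add: completely_rigid_def)
  moreover have "f (g y) = y" if "y \<in> wild_set n Y" for y
    using rigid_set_fixed[OF homotopic_with_symD[OF fg], of y n] that assms(4)
    by (simp add: completely_rigid_def)
  moreover have "f ` wild_set n X \<subseteq> wild_set n Y" "g ` wild_set n Y \<subseteq> wild_set n X"
    using wild_set_image_subset f g gf fg by blast+
  \<comment> \<open>The image inclusions let \<open>f\<close> and \<open>g\<close> restrict to
    continuous maps between the wild sets; the pointwise identities make these restrictions mutually
    inverse.\<close>
  ultimately have "homeomorphic_maps (subtopology X (wild_set n X)) (subtopology Y (wild_set n Y)) f g"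
    unfolding homeomorphic_maps_def
    by (auto simp: continuous_map_in_subtopology continuous_map_from_subtopology f g)
  then show ?thesis
    unfolding homeomorphic_space_def by blast
qed

end
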